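(* Let $n\ge 1$ and let $\mathcal F=\{f_1,\dots,f_k\}$ be a family of vectors in $\mathbb Z_2^n$. Then $\mathcal F$ is a Parseval frame if and only if its frame operator $S_{\mathcal F}$ is equal to the $n\times n$ identity matrix.
   Context: $\mathbb Z_2$ is the field with two elements. The dot product on $\mathbb Z_2^n$ is $(a,b)=\sum_{i=1}^n a_ib_i\in\mathbb Z_2$. A family (finite indexed list, repetitions allowed) $\{f_1,\dots,f_k\}$ of vectors in $\mathbb Z_2^n$ is a Parseval frame if $x=\sum_{j=1}^k (x,f_j)f_j$ for all $x\in\mathbb Z_2^n$. The analysis operator $\Theta_{\mathcal F}$ is the $k\times n$ matrix over $\mathbb Z_2$ whose $i$-th row is $f_i$; the synthesis operator $\Theta_{\mathcal F}^*$ is its transpose, the $n\times k$ matrix whose $i$-th column is $f_i$. The frame operator is the $n\times n$ matrix $S_{\mathcal F}:=\Theta_{\mathcal F}^*\Theta_{\mathcal F}$. *)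

theory Defs
  imports "HOL-Library.Z2" "Jordan_Normal_Form.Matrix"
begin

text \<open>
  \<^typ>\<open>bit\<close> is the field with two elements, so \<^term>\<open>carrier_vec n :: bit vec set\<close> is the
  $n$-dimensional space over it, and \<^const>\<open>scalar_prod\<close> (written \<open>\<bullet>\<close>) is the dot product.
  A family \<open>f\<^sub>1, \<dots>, f\<^sub>k\<close> of vectors is a list \<open>fs\<close> of length \<open>k\<close>, indexed from \<open>0\<close>.
\<close>

definition parseval_frame :: "nat \<Rightarrow> bit vec list \<Rightarrow> bool" where
  "parseval_frame n fs \<longleftrightarrow>
     set fs \<subseteq> carrier_vec n \<and>
     (\<forall>x \<in> carrier_vec n.
        x = finsum_vec TYPE(bit) n (\<lambda>j. (x \<bullet> (fs ! j)) \<cdot>\<^sub>v (fs ! j)) {..<length fs})"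

definition analysis_operator :: "nat \<Rightarrow> bit vec list \<Rightarrow> bit mat" where
  "analysis_operator n fs = mat_of_rows n fs"

definition synthesis_operator :: "nat \<Rightarrow> bit vec list \<Rightarrow> bit mat" where
  "synthesis_operator n fs = transpose_mat (analysis_operator n fs)"

definition frame_operator :: "nat \<Rightarrow> bit vec list \<Rightarrow> bit mat" where
  "frame_operator n fs = synthesis_operator n fs * analysis_operator n fs"

end

theory Submission
  imports Defs
begin

text \<open>Applying the analysis operator to \<open>x\<close> lists the coefficients of
  \<open>x\<close> against the family, and the synthesis operator recombines the vectors with these
  coefficients. So the reconstruction sum is the frame operator applied to \<open>x\<close>
  (\<open>frame_operator_mult_vec\<close>), and the Parseval condition says that this operator fixes
  every vector. Only the identity matrix does so (\<open>mat_eq_one_iff_fixes_vecs\<close>).\<close>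

lemma frame_operator_carrier [simp]: "frame_operator n fs \<in> carrier_mat n n"
  by (intro carrier_matI)
    (simp_all add: frame_operator_def synthesis_operator_def analysis_operator_def)

text \<open>Associativity splits the product into analysis followed by synthesis; the two sides are
  then compared coordinate by coordinate.\<close>

lemma frame_operator_mult_vec:
  assumes fs: "set fs \<subseteq> carrier_vec n" and x: "x \<in> carrier_vec n"
  shows "frame_operator n fs *\<^sub>v x =
    finsum_vec TYPE(bit) n (\<lambda>j. (x \<bullet> (fs ! j)) \<cdot>\<^sub>v (fs ! j)) {..<length fs}"
    (is "_ = finsum_vec _ _ ?g ?J")
proof (rule eq_vecI)
  have nth: "fs ! j \<in> carrier_vec n" if "j < length fs" for j
    using fs that nth_mem by blast
  have g: "?g \<in> ?J \<rightarrow> carrier_vec n"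
    using nth by simp
  let ?A = "mat_of_rows n fs"
  have A: "?A \<in> carrier_mat (length fs) n"
    by simp
  show "dim_vec (frame_operator n fs *\<^sub>v x) = dim_vec (finsum_vec TYPE(bit) n ?g ?J)"
    using finsum_vec_closed[OF g] carrier_matD(1)[OF frame_operator_carrier] by auto
  fix i assume "i < dim_vec (finsum_vec TYPE(bit) n ?g ?J)"
  then have i: "i < n"
    using finsum_vec_closed[OF g] by auto
  have "(frame_operator n fs *\<^sub>v x) $ i = (transpose_mat ?A *\<^sub>v (?A *\<^sub>v x)) $ i"
    using assoc_mult_mat_vec[OF transpose_carrier_mat[THEN iffD2, OF A] A x]
    by (simp add: frame_operator_def synthesis_operator_def analysis_operator_def)
  \<comment> \<open>Row \<open>i\<close> of the transpose collects the \<open>i\<close>-th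
    coordinates of the family, and entry \<open>j\<close> of \<open>?A *\<^sub>v x\<close> is
    \<open>fs ! j \<bullet> x\<close>.\<close>
  also have "\<dots> = (\<Sum>j<length fs. fs ! j $ i * (fs ! j \<bullet> x))"
    using i nth by (simp add: scalar_prod_def mat_of_rows_index lessThan_atLeast0)
  also have "\<dots> = (\<Sum>j<length fs. ?g j $ i)"
  proof (rule sum.cong)
    fix j assume "j \<in> ?J"
    then have j: "fs ! j \<in> carrier_vec n" using nth by simp
    \<comment> \<open>The matrix product puts \<open>x\<close> second in the dot product, the frame
      sum puts it first; symmetry reconciles them.\<close>
    then show "fs ! j $ i * (fs ! j \<bullet> x) = ?g j $ i"
      using i comm_scalar_prod[OF j x] by (simp add: mult.commute)
  qed simp
  also have "\<dots> = finsum_vec TYPE(bit) n ?g ?J $ i"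
    using index_finsum_vec[OF _ i g] by simp
  finally show "(frame_operator n fs *\<^sub>v x) $ i = finsum_vec TYPE(bit) n ?g ?J $ i" .
qed

text \<open>Column \<open>j\<close> of \<open>A\<close> is the image of the \<open>j\<close>-th unit
  vector, so the action on unit vectors already determines \<open>A\<close>.\<close>

lemma mat_eq_one_iff_fixes_vecs:
  fixes A :: "'a :: semiring_1 mat"
  assumes "A \<in> carrier_mat n n"
  shows "A = 1\<^sub>m n \<longleftrightarrow> (\<forall>x \<in> carrier_vec n. x = A *\<^sub>v x)"
proof
  assume fixed: "\<forall>x \<in> carrier_vec n. x = A *\<^sub>v x"
  show "A = 1\<^sub>m n"
  proof (rule eq_matI)
    fix i j assume "i < dim_row (1\<^sub>m n :: 'a mat)" "j < dim_col (1\<^sub>m n :: 'a mat)"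
    then have "i < n" "j < n" by simp_all
    then have "A $$ (i, j) = (A *\<^sub>v unit_vec n j) $ i"
      using assms by simp
    also have "\<dots> = unit_vec n j $ i"
      using fixed by (metis unit_vec_carrier)
    finally show "A $$ (i, j) = 1\<^sub>m n $$ (i, j)"
      using \<open>i < n\<close> \<open>j < n\<close> by simp
  qed (use assms in auto)
qed simp

theorem theorem4p6:
  fixes n :: nat and fs :: "bit vec list"
  assumes "n \<ge> 1"
    and "set fs \<subseteq> carrier_vec n"
  shows "parseval_frame n fs \<longleftrightarrow> frame_operator n fs = 1\<^sub>m n"
  using assms(2)
  \<comment> \<open>The assumption on \<open>fs\<close> settles the carrier conjunct of
    \<open>parseval_frame\<close>; what remains is the same equation for each \<open>x\<close> on
    both sides.\<close>
  by (simp add: parseval_frame_def mat_eq_one_iff_fixes_vecs frame_operator_mult_vec)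

end
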